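(* Let $N\ge 3$ and let $G=(\cdots((G_0\circ G_1)\circ G_2)\cdots)\circ G_{N-2}$ be the nested corona product of the graphs $G_0=\Pi_0^G$ and $G_j=\overline{\Pi}_j^G$, $1\le j\le N-2$, where $\Pi_0^G$ is the path graph on $2$ vertices and $\overline{\Pi}_j^G$ is the path graph on $j+1$ vertices. Then $|V(G)|=N!$.
   Context: Corona product: for graphs $G$ on $n$ vertices and $H$ on $k$ vertices, $G\circ H$ is formed by taking one copy of $G$ and $n$ copies of $H$ and joining the $i$-th vertex of $G$ by an edge to every vertex of the $i$-th copy of $H$, for each $i$. The nested corona product of a sequence of simple graphs $G_0,G_1,\ldots,G_{N-2}$ is $(\cdots((G_0\circ G_1)\circ G_2)\cdots)\circ G_{N-2}$. $V(G)$ is the vertex set of $G$. With $s_j=(j,j+1)$ the adjacent transpositions, $\Pi_0^G$ is the path (one edge) with vertices labelled $I$ and $s_0$, and for $k\ge1$, $\overline{\Pi}_k^G$ is the path graph whose consecutive vertices are labelled $s_k,\ s_ks_{k-1},\ \ldots,\ s_ks_{k-1}\cdots s_0$ ($k+1$ vertices). *)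

theory Defs
  imports "Graph_Theory.Pair_Digraph" "HOL-Combinatorics.Transposition"
begin

text \<open>
  Simple graphs are those of the \<^locale>\<open>pair_graph\<close> locale: finite, loop-free, symmetric
  sets of arcs. An edge is a pair of opposite arcs.
\<close>

section \<open>Corona products\<close>

text \<open>
  \<open>Inl v\<close> is the vertex \<open>v\<close> of \<open>G\<close>; \<open>Inr (v, w)\<close> is the vertex \<open>w\<close> in the copy of \<open>H\<close>
  attached to \<open>v\<close>.
\<close>

definition corona ::
  "'a pair_pre_digraph \<Rightarrow> 'b pair_pre_digraph \<Rightarrow> ('a + 'a \<times> 'b) pair_pre_digraph" where
  "corona G H =
    \<lparr> pverts = Inl ` pverts G \<union> Inr ` (pverts G \<times> pverts H),
      parcs = {(Inl u, Inl v) | u v. (u, v) \<in> parcs G}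
        \<union> {(Inr (v, x), Inr (v, y)) | v x y. v \<in> pverts G \<and> (x, y) \<in> parcs H}
        \<union> {(Inl v, Inr (v, w)) | v w. v \<in> pverts G \<and> w \<in> pverts H}
        \<union> {(Inr (v, w), Inl v) | v w. v \<in> pverts G \<and> w \<in> pverts H} \<rparr>"

definition relabel :: "('a \<Rightarrow> 'b) \<Rightarrow> 'a pair_pre_digraph \<Rightarrow> 'b pair_pre_digraph" where
  "relabel f G = \<lparr> pverts = f ` pverts G, parcs = map_prod f f ` parcs G \<rparr>"

text \<open>
  Each corona product changes the vertex type, so an iterated product needs one type holding the
  vertices of all stages. The relabelling \<open>fold_vert\<close> is injective, hence every stage of
  \<open>nested_corona\<close> is an isomorphic copy of the corona product it is built from.
\<close>

datatype 'a cvert = Base 'a | Old "'a cvert" | New "'a cvert" 'a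

definition fold_vert :: "'a cvert + 'a cvert \<times> 'a \<Rightarrow> 'a cvert" where
  "fold_vert = case_sum Old (\<lambda>(v, w). New v w)"

lemma inj_fold_vert: "inj fold_vert"
  by (auto simp: inj_def fold_vert_def split: sum.splits)

primrec nested_corona :: "(nat \<Rightarrow> 'a pair_pre_digraph) \<Rightarrow> nat \<Rightarrow> 'a cvert pair_pre_digraph" where
  "nested_corona F 0 = relabel Base (F 0)"
| "nested_corona F (Suc m) = relabel fold_vert (corona (nested_corona F m) (F (Suc m)))"

lemma pair_graph_corona:
  assumes "pair_graph G" and "pair_graph H"
  shows "pair_graph (corona G H)"
proof -
  interpret G: pair_graph G by fact
  interpret H: pair_graph H by fact
  have G: "(u, v) \<in> parcs G \<Longrightarrow> u \<in> pverts G \<and> v \<in> pverts G \<and> (v, u) \<in> parcs G \<and> u \<noteq> v" for u v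
    using G.in_arcsD1 G.in_arcsD2 G.pair_sym_arcs G.pair_no_loops
    by (fastforce simp: symmetric_def dest: symD)
  have H: "(u, v) \<in> parcs H \<Longrightarrow> u \<in> pverts H \<and> v \<in> pverts H \<and> (v, u) \<in> parcs H \<and> u \<noteq> v" for u v
    using H.in_arcsD1 H.in_arcsD2 H.pair_sym_arcs H.pair_no_loops
    by (fastforce simp: symmetric_def dest: symD)
  have V: "finite (pverts (corona G H))"
    by (simp add: corona_def G.pair_finite_verts H.pair_finite_verts)
  have A: "parcs (corona G H) \<subseteq> pverts (corona G H) \<times> pverts (corona G H)"
    using G H by (auto simp: corona_def)
  have "finite (parcs (corona G H))"
    using finite_subset[OF A] V by simp
  moreover have "sym (parcs (corona G H))"
    using G H by (auto simp: corona_def sym_def)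
  moreover have "fst e \<noteq> snd e" if "e \<in> parcs (corona G H)" for e
    using that G H by (auto simp: corona_def)
  ultimately show ?thesis
    using V A by unfold_locales (auto simp: symmetric_def)
qed

section \<open>Paths labelled by permutations\<close>

definition path_graph :: "'a list \<Rightarrow> 'a pair_pre_digraph" where
  "path_graph xs =
    \<lparr> pverts = set xs,
      parcs = {(xs ! i, xs ! Suc i) | i. Suc i < length xs}
        \<union> {(xs ! Suc i, xs ! i) | i. Suc i < length xs} \<rparr>"

lemma pair_graph_path_graph:
  assumes "distinct xs"
  shows "pair_graph (path_graph xs)"
proof -
  have A: "parcs (path_graph xs) \<subseteq> pverts (path_graph xs) \<times> pverts (path_graph xs)"
    by (auto simp: path_graph_def)
  have V: "finite (pverts (path_graph xs))"
    by (simp add: path_graph_def)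
  have "finite (parcs (path_graph xs))"
    using finite_subset[OF A] V by simp
  moreover have "sym (parcs (path_graph xs))"
    by (auto simp: path_graph_def sym_def)
  moreover have "fst e \<noteq> snd e" if "e \<in> parcs (path_graph xs)" for e
    using that assms by (auto simp: path_graph_def nth_eq_iff_index_eq)
  ultimately show ?thesis
    using V A by unfold_locales (auto simp: symmetric_def)
qed

definition adj_transp :: "nat \<Rightarrow> nat \<Rightarrow> nat" where
  "adj_transp j = transpose j (Suc j)"

text \<open>
  \<open>desc_prod k i\<close> is $s_k s_{k-1} \cdots s_i$ (for \<open>i \<le> k\<close>), the product being composition of maps.
  Multiplying in the opposite order would replace each label by its inverse.
\<close>

definition desc_prod :: "nat \<Rightarrow> nat \<Rightarrow> (nat \<Rightarrow> nat)" where
  "desc_prod k i = foldr (\<circ>) (map adj_transp (rev [i..<Suc k])) id"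

definition Pi0 :: "(nat \<Rightarrow> nat) pair_pre_digraph" where
  "Pi0 = path_graph [id, adj_transp 0]"

definition Pi_bar :: "nat \<Rightarrow> (nat \<Rightarrow> nat) pair_pre_digraph" where
  "Pi_bar k = path_graph (map (desc_prod k) (rev [0..<Suc k]))"

definition corona_factor :: "nat \<Rightarrow> (nat \<Rightarrow> nat) pair_pre_digraph" where
  "corona_factor j = (if j = 0 then Pi0 else Pi_bar j)"

end

(* Attaching a copy of H to every vertex of G multiplies the number of vertices by 1 + |V(H)|.
   For k > 0 the k-th factor has k + 1 vertices, because its labels s_k ... s_i are distinct: i is the only
   point sent to k + 1. Hence the vertex count is 2 * 3 * ... * N. *)
theory Submission
  imports Defs
begin

lemma card_pverts_corona:
  assumes "finite (pverts G)" and "finite (pverts H)"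
  shows "card (pverts (corona G H)) = card (pverts G) * Suc (card (pverts H))"
proof -
  have "pverts (corona G H) = pverts G <+> pverts G \<times> pverts H"
    by (simp add: corona_def Plus_def)
  then show ?thesis
    using assms by (simp add: card_Plus card_cartesian_product)
qed

lemma card_pverts_relabel:
  assumes "inj f"
  shows "card (pverts (relabel f G)) = card (pverts G)"
  using assms by (simp add: relabel_def card_image inj_on_subset)

lemma card_pverts_path_graph:
  assumes "distinct xs"
  shows "card (pverts (path_graph xs)) = length xs"
  using assms by (simp add: path_graph_def distinct_card)

lemma adj_transp_eq_Suc_iff: "adj_transp j x = Suc j \<longleftrightarrow> x = j"
  by (auto simp: adj_transp_def transpose_def)

lemma desc_prod_empty: "desc_prod k (Suc k) = id"
  by (simp add: desc_prod_def)

text \<open>The bound on \<open>i\<close> puts \<open>Suc k\<close> at the end of the index list, so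
  reversal makes the new transposition outermost.\<close>

lemma desc_prod_Suc:
  assumes "i \<le> Suc k"
  shows "desc_prod (Suc k) i = adj_transp (Suc k) \<circ> desc_prod k i"
  using assms by (simp add: desc_prod_def)

text \<open>The outermost factor of \<open>desc_prod (Suc k) i\<close> sends only
  \<open>Suc k\<close> to \<open>Suc (Suc k)\<close>, which reduces the claim to
  \<open>desc_prod k i\<close>. Admitting the empty product \<open>i = Suc k\<close> gives the
  induction its hypothesis for products of one factor.\<close>

lemma desc_prod_eq_Suc_iff:
  assumes "i \<le> Suc k"
  shows "desc_prod k i x = Suc k \<longleftrightarrow> x = i"
  using assms
proof (induction k arbitrary: i)
  case 0
  then consider "i = 0" | "i = Suc 0"
    by linarith
  then show ?case
  proof cases
    case 1
    then show ?thesis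
      by (simp add: desc_prod_def adj_transp_eq_Suc_iff)
  next
    case 2
    then show ?thesis
      by (simp add: desc_prod_empty)
  qed
next
  case (Suc k)
  then show ?case
    by (cases "i = Suc (Suc k)")
      (simp_all add: desc_prod_empty desc_prod_Suc adj_transp_eq_Suc_iff)
qed

lemma inj_on_desc_prod: "inj_on (desc_prod k) {..Suc k}"
proof (rule inj_onI)
  fix i j
  assume "i \<in> {..Suc k}" "j \<in> {..Suc k}" "desc_prod k i = desc_prod k j"
  then show "i = j"
    \<comment> \<open>Both maps are evaluated at the point \<open>i\<close>: the first gives
      \<open>Suc k\<close>, hence so does the second, which forces \<open>i = j\<close>.\<close>
    using desc_prod_eq_Suc_iff[of i k i] desc_prod_eq_Suc_iff[of j k i] by simp
qed

lemma card_pverts_Pi0: "card (pverts Pi0) = 2"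
proof -
  have "id \<noteq> adj_transp 0"
    \<comment> \<open>The two labels differ at the point 0.\<close>
    using adj_transp_eq_Suc_iff[of 0 0] by (metis id_apply nat.distinct(1))
  then show ?thesis
    by (simp add: Pi0_def card_pverts_path_graph)
qed

lemma card_pverts_Pi_bar: "card (pverts (Pi_bar k)) = Suc k"
proof -
  have "inj_on (desc_prod k) (set (rev [0..<Suc k]))"
    by (rule inj_on_subset[OF inj_on_desc_prod]) auto
  then have "distinct (map (desc_prod k) (rev [0..<Suc k]))"
    by (simp only: distinct_map distinct_rev distinct_upt simp_thms)
  then show ?thesis
    unfolding Pi_bar_def by (subst card_pverts_path_graph) simp_all
qed

text \<open>Stage \<open>m\<close> uses the factors 0 to \<open>m\<close>. It starts from 2 = 2!
  vertices, and passing to stage \<open>Suc m\<close> multiplies the count by 1 + (m + 2), whence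
  the shift by two in the factorial.\<close>

lemma card_pverts_nested_corona:
  "card (pverts (nested_corona corona_factor m)) = fact (Suc (Suc m))"
proof (induction m)
  case 0
  have "inj (Base :: (nat \<Rightarrow> nat) \<Rightarrow> _)"
    by (simp add: inj_def)
  then show ?case
    by (simp add: card_pverts_relabel corona_factor_def card_pverts_Pi0)
next
  case (Suc m)
  have "finite (pverts (nested_corona corona_factor m))"
    \<comment> \<open>Infinite sets have \<open>card\<close> 0, so the positive count from the
      induction hypothesis already yields finiteness.\<close>
    by (rule card_ge_0_finite) (simp only: Suc.IH fact_gt_zero)
  moreover have "finite (pverts (Pi_bar (Suc m)))"
    by (simp add: Pi_bar_def path_graph_def)
  ultimately have "card (pverts (nested_corona corona_factor (Suc m)))
      = fact (Suc (Suc m)) * Suc (Suc (Suc m))"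
    by (simp only: nested_corona.simps card_pverts_relabel[OF inj_fold_vert] card_pverts_corona
        corona_factor_def nat.distinct if_False card_pverts_Pi_bar Suc.IH)
  also have "\<dots> = fact (Suc (Suc (Suc m)))"
    by (simp only: fact_Suc of_nat_id mult.commute)
  finally show ?case .
qed

theorem corollary5p4:
  fixes N :: nat
  assumes "N \<ge> 3"
  shows "card (pverts (nested_corona corona_factor (N - 2))) = fact N"
proof -
  \<comment> \<open>Subtraction on \<open>nat\<close> truncates at 0; the bound on \<open>N\<close>
    makes it exact here.\<close>
  have "Suc (Suc (N - 2)) = N"
    using assms by simp
  then show ?thesis
    using card_pverts_nested_corona[of "N - 2"] by simp
qed

end
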